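(* For all $m,r\in\mathbb{N}$ and every word $w=y_rw'$ in the free monoid on $Y=\{y_0,y_1,\ldots\}$ (with $w'$ an arbitrary, possibly empty, word), $$\mathrm{Li}^-_{y_m}\,\mathrm{Li}^-_{w}=\sum_{k=0}^m(-1)^k\binom{m}{k}\mathrm{Li}^-_{y_{m-k}y_{r+k}w'} .$$
   Context: $\mathbb{N}$ is the set of non-negative integers. For $r\ge0$ and $\mathbf{s}=(s_1,\ldots,s_r)\in\mathbb{N}^r$ put $\mathrm{Li}^-_{\mathbf{s}}(z):=\sum_{n_1>\cdots>n_r>0}n_1^{s_1}\cdots n_r^{s_r}z^{n_1}$ for $|z|<1$ (the empty index gives $1$); each is a rational function in $\mathbb{Q}[z,(1-z)^{-1}]$, and products are products of these functions. For a word $w=y_{s_1}\cdots y_{s_r}$ in the free monoid on $Y$ set $\mathrm{Li}^-_w:=\mathrm{Li}^-_{(s_1,\ldots,s_r)}$, and $\mathrm{Li}^-_w:=1$ for the empty word. *)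

theory Defs
  imports "HOL-Analysis.Analysis"
begin

text \<open>
  The word \<open>y\<^bsub>s1\<^esub> \<dots> y\<^bsub>sr\<^esub>\<close> is encoded as the list \<open>[s1, \<dots>, sr]\<close>, so a word and its
  multi-index are the same object.
\<close>

definition desc_tuples :: "nat \<Rightarrow> nat list set" where
  "desc_tuples r = {n. length n = r \<and> sorted_wrt (>) n \<and> (\<forall>i\<in>set n. 0 < i)}"

text \<open>
  The value is meaningful only for \<open>norm z < 1\<close>, where the family is absolutely summable. The empty
  index is a separate case because its only tuple \<open>[]\<close> has no leading entry.
\<close>

definition Li_neg :: "nat list \<Rightarrow> complex \<Rightarrow> complex" where
  "Li_neg s z =
     (if s = [] then 1
      else (\<Sum>\<^sub>\<infinity>n\<in>desc_tuples (length s).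
              (\<Prod>i<length s. of_nat (n ! i) ^ (s ! i)) * z ^ (n ! 0)))"

end

theory Submission
  imports Defs
begin

text \<open>
  Multiplying the series gives the sum of \<open>a\<^sup>m n\<^sub>1\<^sup>r \<dots> z\<^bsup>a + n\<^sub>1\<^esup>\<close> over \<open>a > 0\<close> and \<open>n\<^sub>1 > n\<^sub>2 > \<dots> > 0\<close>.
  Putting \<open>N = a + n\<^sub>1\<close>, the tuples \<open>(N, n\<^sub>1, n\<^sub>2, \<dots>)\<close> are exactly the strictly decreasing tuples with
  one more entry, and the binomial expansion of \<open>a\<^sup>m = (N - n\<^sub>1)\<^sup>m\<close> yields the right-hand side. The same
  reindexing, with \<open>a + n\<^sub>1 \<le> 2 a n\<^sub>1\<close>, shows absolute summability by induction on the depth.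
\<close>

definition Li_term :: "complex \<Rightarrow> nat list \<Rightarrow> nat list \<Rightarrow> complex" where
  "Li_term z s n = (\<Prod>i<length s. of_nat (n ! i) ^ (s ! i)) * z ^ (n ! 0)"

lemma Li_neg_eq_infsum:
  "s \<noteq> [] \<Longrightarrow> Li_neg s z = (\<Sum>\<^sub>\<infinity>n\<in>desc_tuples (length s). Li_term z s n)"
  by (simp add: Li_neg_def Li_term_def)

lemma Li_term_singleton: "Li_term z [m] [a] = of_nat a ^ m * z ^ a"
  by (simp add: Li_term_def)

lemma Li_term_Cons:
  "Li_term z (k # s) (a # n) = of_nat a ^ k * z ^ a * (\<Prod>i<length s. of_nat (n ! i) ^ (s ! i))"
  by (simp add: Li_term_def prod.lessThan_Suc_shift del: prod.lessThan_Suc)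

text \<open>Differentiating the power series with coefficients \<open>n ^ s\<close> and multiplying
  by \<open>z\<close> produces the coefficients \<open>n ^ Suc s\<close>. The induction keeps
  \<open>z\<close> arbitrary because termwise differentiation asks for convergence on the whole open
  unit disc.\<close>

lemma summable_power_times_power:
  fixes z :: complex
  assumes "norm z < 1"
  shows "summable (\<lambda>n. of_nat n ^ s * z ^ n)"
  using assms
proof (induction s arbitrary: z)
  case 0
  then show ?case by (simp add: summable_geometric)
next
  case (Suc s)
  have "summable (\<lambda>n. diffs (\<lambda>n. of_nat n ^ s) n * z ^ n)"
    using Suc by (intro termdiff_converges[where K = 1]) auto
  from summable_mult2[OF this, of z]
  have "summable (\<lambda>n. of_nat (Suc n) ^ Suc s * z ^ Suc n)"
    by (simp add: diffs_def mult_ac)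
  then show ?case
    by (subst (asm) summable_Suc_iff)
qed

lemma summable_on_power_times_power:
  fixes z :: complex
  assumes "norm z < 1"
  shows "(\<lambda>n. of_nat n ^ s * z ^ n) summable_on A"
proof -
  \<comment> \<open>The point \<open>norm z\<close> lies in the unit disc as well, and the series
    there is the series of norms at \<open>z\<close>. Its convergence gives unordered
    summability.\<close>
  have "summable (\<lambda>n. of_nat n ^ s * complex_of_real (norm z) ^ n)"
    using assms by (intro summable_power_times_power) simp
  also have "(\<lambda>n. of_nat n ^ s * complex_of_real (norm z) ^ n) =
      (\<lambda>n. of_real (norm (of_nat n ^ s * z ^ n)))"
    by (simp add: norm_mult norm_power)
  finally have "summable (\<lambda>n. norm (of_nat n ^ s * z ^ n))"
    by (simp only: summable_complex_of_real)
  then have "(\<lambda>n. of_nat n ^ s * z ^ n) summable_on UNIV"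
    by (rule norm_summable_imp_summable_on)
  then show ?thesis
    by (rule summable_on_subset_banach) auto
qed

lemma summable_on_comparison_complex:
  fixes f g :: "'a \<Rightarrow> complex"
  assumes "g summable_on A" "\<And>x. x \<in> A \<Longrightarrow> norm (f x) \<le> norm (g x)"
  shows "f summable_on A"
  using assms Infinite_Sum.abs_summable_on_comparison_test[of g A f]
  unfolding summable_on_iff_abs_summable_on_complex by blast

text \<open>For complex families summability is absolute summability, so iterated sums of norms
  suffice: for fixed \<open>x\<close> the inner sum is \<open>norm (f x)\<close> times a constant,
  which is summable in \<open>x\<close>.\<close>

lemma summable_on_times_complex:
  fixes f :: "'a \<Rightarrow> complex" and g :: "'b \<Rightarrow> complex"
  assumes "f summable_on A" "g summable_on B"
  shows "(\<lambda>(x, y). f x * g y) summable_on A \<times> B"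
  using assms
  unfolding summable_on_iff_abs_summable_on_complex Infinite_Sum.abs_summable_on_Sigma_iff
  by (auto simp: norm_mult infsum_cmult_right' abs_mult
      intro!: summable_on_cmult_right summable_on_cmult_left)

lemma infsum_times_infsum_complex:
  fixes f :: "'a \<Rightarrow> complex" and g :: "'b \<Rightarrow> complex"
  assumes "f summable_on A" "g summable_on B"
  shows "infsum f A * infsum g B = (\<Sum>\<^sub>\<infinity>(x, y)\<in>A \<times> B. f x * g y)"
  using infsum_Sigma'_banach[OF summable_on_times_complex[OF assms]]
  by (simp add: infsum_cmult_right' infsum_cmult_left')

lemma infsum_sum:
  fixes f :: "'i \<Rightarrow> 'a \<Rightarrow> complex"
  assumes "finite I" "\<And>i. i \<in> I \<Longrightarrow> f i summable_on A"
  shows "(\<Sum>\<^sub>\<infinity>x\<in>A. \<Sum>i\<in>I. f i x) = (\<Sum>i\<in>I. infsum (f i) A)"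
proof -
  have "((\<lambda>x. \<Sum>i\<in>I. f i x) has_sum (\<Sum>i\<in>I. infsum (f i) A)) A"
    using assms by (induction I rule: finite_induct) (auto intro!: has_sum_add)
  then show ?thesis
    by (rule infsumI)
qed

lemma bij_betw_desc_tuples_1: "bij_betw (\<lambda>a. [a]) {0<..} (desc_tuples 1)"
  by (rule bij_betwI[where g = hd]) (auto simp: desc_tuples_def length_Suc_conv)

text \<open>The positive number \<open>a\<close> is the gap between the two leading entries of the
  longer tuple. The length \<open>Suc q\<close> ensures that \<open>n\<close> is nonempty, so that
  \<open>hd n\<close> is its largest entry.\<close>

lemma bij_betw_desc_tuples_Suc:
  "bij_betw (\<lambda>(a, n). (a + hd n) # n) ({0<..} \<times> desc_tuples (Suc q)) (desc_tuples (Suc (Suc q)))"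
proof (rule bij_betwI[where g = "\<lambda>n. (hd n - hd (tl n), tl n)"])
  show "(\<lambda>(a, n). (a + hd n) # n) \<in> {0<..} \<times> desc_tuples (Suc q) \<rightarrow> desc_tuples (Suc (Suc q))"
    by (auto simp: desc_tuples_def length_Suc_conv trans_less_add2)
qed (auto simp: desc_tuples_def length_Suc_conv)

text \<open>The leading exponent \<open>k\<close> is generalised because the comparison series of
  smaller depth has leading exponent \<open>k + l\<close>.\<close>

lemma summable_on_Li_term:
  assumes "norm z < 1"
  shows "Li_term z (k # s) summable_on desc_tuples (Suc (length s))"
proof (induction s arbitrary: k)
  case Nil
  have "(\<lambda>a. Li_term z [k] [a]) summable_on {0<..}"
    unfolding Li_term_singleton by (rule summable_on_power_times_power[OF assms])
  then show ?case
    using summable_on_reindex_bij_betw[OF bij_betw_desc_tuples_1, of "Li_term z [k]"]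
    by simp
next
  case (Cons l s)
  let ?D = "desc_tuples (Suc (length s))"
  \<comment> \<open>With \<open>h = hd n\<close>, \<open>(a + h) ^ k\<close> is at most
    \<open>2 ^ k * a ^ k * h ^ k\<close>; the factor \<open>h ^ k\<close> joins
    \<open>h ^ l\<close>, and \<open>z ^ (a + h)\<close> splits, so the bound separates
    \<open>a\<close> from \<open>n\<close>.\<close>
  let ?g = "\<lambda>(a, n). (2 ^ k * (of_nat a ^ k * z ^ a)) * Li_term z ((k + l) # s) n"
  have "(\<lambda>(a, n). Li_term z (k # l # s) ((a + hd n) # n)) summable_on {0<..} \<times> ?D"
  proof (rule summable_on_comparison_complex)
    have "(\<lambda>a. 2 ^ k * (of_nat a ^ k * z ^ a)) summable_on {0<..}"
      by (intro summable_on_cmult_right summable_on_power_times_power assms)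
    then show "?g summable_on {0<..} \<times> ?D"
      by (rule summable_on_times_complex[OF _ Cons.IH])
  next
    fix x :: "nat \<times> nat list"
    assume "x \<in> {0<..} \<times> ?D"
    then obtain a h t where x: "x = (a, h # t)" "0 < a" "0 < h"
      by (auto simp: desc_tuples_def length_Suc_conv)
    have "a + h \<le> 2 * a * h"
      using x by (cases a; cases h) auto
    then have "real (a + h) ^ k \<le> real (2 * a * h) ^ k"
      by (intro power_mono) (simp_all only: of_nat_le_iff of_nat_0_le_iff)
    \<comment> \<open>Here \<open>P\<close> stands for the norm of the product over the entries
      below \<open>h\<close>, which is the same on both sides.\<close>
    then have "real (a + h) ^ k * (norm z ^ (a + h) * (real h ^ l * P)) \<le>
        real (2 * a * h) ^ k * (norm z ^ (a + h) * (real h ^ l * P))" if "P \<ge> 0" for P :: real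
      using that by (intro mult_right_mono) auto
    from this[of "norm (\<Prod>i<length s. of_nat (t ! i) ^ (s ! i) :: complex)"]
    show "norm (case x of (a, n) \<Rightarrow> Li_term z (k # l # s) ((a + hd n) # n)) \<le> norm (?g x)"
      by (simp add: x Li_term_Cons norm_mult norm_power power_mult_distrib power_add mult_ac
          prod.lessThan_Suc_shift del: prod.lessThan_Suc of_nat_add flip: of_nat_add)
  qed
  then show ?case
    using summable_on_reindex_bij_betw[OF bij_betw_desc_tuples_Suc,
        of "Li_term z (k # l # s)" "length s"]
    by (simp add: case_prod_unfold)
qed

lemma Li_term_times_Li_term:
  "Li_term z [m] [a] * Li_term z (r # w) (h # n) =
    (\<Sum>k=0..m. (-1) ^ k * of_nat (m choose k) * Li_term z ((m - k) # (r + k) # w) ((a + h) # h # n))"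
proof -
  \<comment> \<open>Writing \<open>- h\<close> first makes the binomial index \<open>k\<close> the
    exponent of \<open>h\<close>; this yields the sign and raises the second exponent to
    \<open>r + k\<close>.\<close>
  have "(of_nat a :: complex) ^ m = (- of_nat h + of_nat (a + h)) ^ m"
    by simp
  also have "\<dots> = (\<Sum>k=0..m. (-1) ^ k * of_nat (m choose k) * of_nat (a + h) ^ (m - k) * of_nat h ^ k)"
    unfolding binomial_ring atMost_atLeast0
    by (intro sum.cong refl) (simp add: power_minus[of "of_nat h"] mult_ac)
  finally show ?thesis
    by (simp add: Li_term_Cons Li_term_singleton sum_distrib_right sum_distrib_left
        prod.lessThan_Suc_shift power_add mult_ac del: prod.lessThan_Suc of_nat_add)
qed

theorem theorem4p5:
  fixes m r :: nat and w w' :: "nat list" and z :: complex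
  assumes "w = r # w'" and "norm z < 1"
  shows "Li_neg [m] z * Li_neg w z =
    (\<Sum>k=0..m. (-1) ^ k * of_nat (m choose k) * Li_neg ((m - k) # (r + k) # w') z)"
proof -
  let ?q = "Suc (length w')"
  let ?c = "\<lambda>k. (-1) ^ k * of_nat (m choose k) :: complex"
  let ?s = "\<lambda>k. (m - k) # (r + k) # w'"
  have "Li_neg [m] z = (\<Sum>\<^sub>\<infinity>a\<in>{0<..}. Li_term z [m] [a])"
    using infsum_reindex_bij_betw[OF bij_betw_desc_tuples_1, of "Li_term z [m]"]
    by (simp add: Li_neg_eq_infsum)
  moreover have "Li_neg w z = (\<Sum>\<^sub>\<infinity>n\<in>desc_tuples ?q. Li_term z w n)"
    by (simp add: Li_neg_eq_infsum assms)
  moreover have "(\<lambda>a. Li_term z [m] [a]) summable_on {0<..}"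
    unfolding Li_term_singleton by (rule summable_on_power_times_power[OF assms(2)])
  moreover have "Li_term z w summable_on desc_tuples ?q"
    unfolding assms(1) by (rule summable_on_Li_term[OF assms(2)])
  ultimately have "Li_neg [m] z * Li_neg w z =
      (\<Sum>\<^sub>\<infinity>(a, n)\<in>{0<..} \<times> desc_tuples ?q. Li_term z [m] [a] * Li_term z w n)"
    by (simp add: infsum_times_infsum_complex)
  \<comment> \<open>The pair now enters only through the tuple \<open>(a + hd n) # n\<close>, the
    form needed to reindex along the bijection.\<close>
  also have "\<dots> = (\<Sum>\<^sub>\<infinity>x\<in>{0<..} \<times> desc_tuples ?q.
      \<Sum>k=0..m. ?c k * Li_term z (?s k) (case x of (a, n) \<Rightarrow> (a + hd n) # n))"
    by (intro infsum_cong)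
      (auto simp: desc_tuples_def length_Suc_conv assms(1) Li_term_times_Li_term)
  also have "\<dots> = (\<Sum>\<^sub>\<infinity>n\<in>desc_tuples (Suc ?q). \<Sum>k=0..m. ?c k * Li_term z (?s k) n)"
    by (rule infsum_reindex_bij_betw[OF bij_betw_desc_tuples_Suc])
  also have "\<dots> = (\<Sum>k=0..m. \<Sum>\<^sub>\<infinity>n\<in>desc_tuples (Suc ?q). ?c k * Li_term z (?s k) n)"
  proof (rule infsum_sum, simp)
    fix k
    show "(\<lambda>n. ?c k * Li_term z (?s k) n) summable_on desc_tuples (Suc ?q)"
      using summable_on_Li_term[OF assms(2), of "m - k" "(r + k) # w'"]
      by (intro summable_on_cmult_right) simp
  qed
  also have "\<dots> = (\<Sum>k=0..m. ?c k * Li_neg (?s k) z)"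
    by (simp add: infsum_cmult_right' Li_neg_eq_infsum)
  finally show ?thesis .
qed

end
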